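(* Let $(V,V^+)$ be a complete order smooth $1$-normed space satisfying condition $(OS.1.2)$ and let $W$ be a closed cone in $V$. Then for any $v\in V^+$ there are $w\in W^+:=W\cap V^+$ and $w'\in W'^{+}:=W'\cap V^+$ such that $v=w+w'$ and $\|v\|=\|w\|+\|w'\|$.
   Context: A cone in a real vector space $V$ is a non-empty subset $C$ with $\lambda C\subseteq C$ for all $\lambda\ge 0$ and $C+C\subseteq C$; it is proper if $C\cap -C=\{0\}$ and generating if $V=C-C$. Let $(V,V^+)$ be a real ordered vector space whose positive cone $V^+$ is proper and generating, with a norm in which $V^+$ is closed. $V$ is an order smooth $1$-normed space if: $(O.1.1)$ $u\le v\le w$ implies $\|v\|\le \|u\|+\|w\|$; $(O.1.2)$ for $v\in V$ and $\epsilon>0$ there are $v_1,v_2\in V^+$ with $v=v_1-v_2$ and $\|v_1\|+\|v_2\|\le\|v\|+\epsilon$. $V$ satisfies $(OS.1.2)$ if for every $v\in V$ there are $v_1,v_2\in V^+$ with $v=v_1-v_2$ and $\|v\|\ge \|v_1\|+\|v_2\|$. A face of a convex set $K$ is a non-empty convex subset $F\subseteq K$ such that $x,y\in K$ and $\lambda x+(1-\lambda)y\in F$ for some $0<\lambda<1$ imply $x,y\in F$. For $x\in K$, $\mathrm{face}_K(x)$ is the smallest face of $K$ containing $x$. For a convex set $K$, $\mathrm{cone}(K)=\bigcup_{\lambda\ge0}\lambda K$. Let $V_1$ be the closed unit ball of the normed space $V$. For $v\ne0$ put $C(v)=\mathrm{cone}(\mathrm{face}_{V_1}(v/\|v\|))$,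 and $C(0)=\{0\}$. For a cone $C\subseteq V$, $C'=\{v\in V: C\cap C(v)=\{0\}\}$ (not convex in general). *)

theory Defs
  imports "HOL-Analysis.Analysis"
begin

text \<open>
  Cones are the library's \<^const>\<open>convex_cone\<close>, and faces are the non-empty instances of
  \<^const>\<open>face_of\<close>; the next two lemmas identify both with the definitions by
  \<open>\<lambda>C \<subseteq> C\<close>, \<open>C + C \<subseteq> C\<close> and by convex combinations.
\<close>

lemma convex_cone_iff_closed_under:
  "convex_cone C \<longleftrightarrow> C \<noteq> {} \<and> (\<forall>c\<ge>0. (*\<^sub>R) c ` C \<subseteq> C) \<and> {x + y |x y. x \<in> C \<and> y \<in> C} \<subseteq> C"
proof
  assume "convex_cone C"
  then show "C \<noteq> {} \<and> (\<forall>c\<ge>0. (*\<^sub>R) c ` C \<subseteq> C) \<and> {x + y |x y. x \<in> C \<and> y \<in> C} \<subseteq> C"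
    by (auto simp: convex_cone_iff)
next
  assume *: "C \<noteq> {} \<and> (\<forall>c\<ge>0. (*\<^sub>R) c ` C \<subseteq> C) \<and> {x + y |x y. x \<in> C \<and> y \<in> C} \<subseteq> C"
  then obtain x where "x \<in> C" by blast
  with * have "0 *\<^sub>R x \<in> C" by (meson image_subset_iff order_refl)
  with * show "convex_cone C"
    by (fastforce simp: convex_cone_iff)
qed

lemma face_of_iff_convex_combination:
  "F face_of K \<longleftrightarrow> F \<subseteq> K \<and> convex F \<and>
    (\<forall>x\<in>K. \<forall>y\<in>K. \<forall>c::real. 0 < c \<and> c < 1 \<and> c *\<^sub>R x + (1 - c) *\<^sub>R y \<in> F \<longrightarrow> x \<in> F \<and> y \<in> F)"
  (is "_ \<longleftrightarrow> _ \<and> _ \<and> ?P")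
proof -
  have "?P \<longleftrightarrow> (\<forall>a\<in>K. \<forall>b\<in>K. \<forall>x\<in>F. x \<in> open_segment a b \<longrightarrow> a \<in> F \<and> b \<in> F)" (is "_ \<longleftrightarrow> ?Q")
  proof
    assume P: ?P
    show ?Q
    proof (intro ballI impI)
      fix a b x assume "a \<in> K" "b \<in> K" "x \<in> F" "x \<in> open_segment a b"
      then obtain u where "0 < u" "u < 1" "x = (1 - u) *\<^sub>R a + u *\<^sub>R b"
        by (auto simp: in_segment)
      then show "a \<in> F \<and> b \<in> F"
        using P[rule_format, of a b "1 - u"] \<open>a \<in> K\<close> \<open>b \<in> K\<close> \<open>x \<in> F\<close> by simp
    qed
  next
    assume Q: ?Q
    show ?P
    proof (intro ballI allI impI)
      fix x y and c :: real
      assume xy: "x \<in> K" "y \<in> K" and c: "0 < c \<and> c < 1 \<and> c *\<^sub>R x + (1 - c) *\<^sub>R y \<in> F"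
      show "x \<in> F \<and> y \<in> F"
      proof (cases "x = y")
        case True
        with c show ?thesis by (simp flip: scaleR_add_left)
      next
        case False
        with c have "c *\<^sub>R x + (1 - c) *\<^sub>R y \<in> open_segment x y"
          by (auto simp: in_segment intro!: exI[of _ "1 - c"])
        with Q xy c show ?thesis by blast
      qed
    qed
  qed
  then show ?thesis by (simp add: face_of_def)
qed

definition cone_le :: "'a::real_vector set \<Rightarrow> 'a \<Rightarrow> 'a \<Rightarrow> bool" where
  "cone_le P u v \<longleftrightarrow> v - u \<in> P"

definition proper_cone :: "'a::real_vector set \<Rightarrow> bool" where
  "proper_cone C \<longleftrightarrow> convex_cone C \<and> C \<inter> uminus ` C = {0}"

definition generating_cone :: "'a::real_vector set \<Rightarrow> bool" where
  "generating_cone C \<longleftrightarrow> convex_cone C \<and> (UNIV :: 'a set) = {x - y |x y. x \<in> C \<and> y \<in> C}"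

text \<open>
  The ordered normed space is the whole type, with positive cone \<open>P\<close>. Completeness is not
  part of these predicates; it is expressed by the type class \<^class>\<open>banach\<close>.
\<close>

definition order_smooth_1_normed :: "'a::real_normed_vector set \<Rightarrow> bool" where
  "order_smooth_1_normed P \<longleftrightarrow>
     proper_cone P \<and> generating_cone P \<and> closed P \<and>
     (\<forall>u v w. cone_le P u v \<and> cone_le P v w \<longrightarrow> norm v \<le> norm u + norm w) \<and>
     (\<forall>v. \<forall>\<epsilon>>0. \<exists>v1\<in>P. \<exists>v2\<in>P. v = v1 - v2 \<and> norm v1 + norm v2 \<le> norm v + \<epsilon>)"

definition OS_1_2 :: "'a::real_normed_vector set \<Rightarrow> bool" where
  "OS_1_2 P \<longleftrightarrow> (\<forall>v. \<exists>v1\<in>P. \<exists>v2\<in>P. v = v1 - v2 \<and> norm v \<ge> norm v1 + norm v2)"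

definition face_at :: "'a::real_vector set \<Rightarrow> 'a \<Rightarrow> 'a set" where
  "face_at K x = \<Inter>{F. F face_of K \<and> x \<in> F}"

lemma face_at_smallest:
  assumes "convex K" "x \<in> K"
  shows "face_at K x face_of K" "x \<in> face_at K x"
    and "\<And>F. F face_of K \<Longrightarrow> x \<in> F \<Longrightarrow> face_at K x \<subseteq> F"
proof -
  have "K \<in> {F. F face_of K \<and> x \<in> F}"
    using assms face_of_refl by blast
  then show "face_at K x face_of K"
    unfolding face_at_def by (intro face_of_Inter) auto
qed (auto simp: face_at_def)

definition cone_of :: "'a::real_vector set \<Rightarrow> 'a set" where
  "cone_of K = (\<Union>c\<in>{0::real..}. (*\<^sub>R) c ` K)"

text \<open>\<open>facial_cone v\<close> is the set $C(v)$; \<open>complementary_set C\<close> is $C'$.\<close>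

definition facial_cone :: "'a::real_normed_vector \<Rightarrow> 'a set" where
  "facial_cone v = (if v = 0 then {0} else cone_of (face_at (cball 0 1) (v /\<^sub>R norm v)))"

definition complementary_set :: "'a::real_normed_vector set \<Rightarrow> 'a set" where
  "complementary_set C = {v. C \<inter> facial_cone v = {0}}"

end

(* The relation "w2 - w1 is in W and norm (v - w1) = norm (w2 - w1) + norm (v - w2)" between w1
   and w2 is a partial order with closed upper sets in which distances are controlled by the decrease of norm (v - w). Completeness therefore yields a maximal
   w above 0. An element of C(v - w) is, up to scaling, a summand y of v - w with
   norm (v - w) = norm y + norm (v - w - y), so by maximality none of them except 0 is in W.
   Finally, norm-additive summands of a positive element are positive: splitting them by (OS.1.2),
   the positive parts alone already dominate v, which leaves no norm for the negative parts. *)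
theory Submission
  imports Defs
begin

text \<open>A maximality principle of Ekeland type. From \<open>a\<close>, pass repeatedly to a
  point above the current one where \<open>f\<close> is nearly minimal among all points above. The
  values of \<open>f\<close> decrease and are bounded below, so they converge, and
  \<open>dist\<close> makes the sequence Cauchy. By closedness its limit lies above every term, and
  \<open>f\<close> cannot drop any further above the limit.\<close>

lemma ex_maximal_of_dist_le_decrease:
  fixes R :: "'a::complete_space \<Rightarrow> 'a \<Rightarrow> bool" and f :: "'a \<Rightarrow> real"
  assumes refl: "\<And>x. R x x"
    and trans: "\<And>x y z. R x y \<Longrightarrow> R y z \<Longrightarrow> R x z"
    and closed: "\<And>x. closed {y. R x y}"
    and dist: "\<And>x y. R x y \<Longrightarrow> dist x y \<le> f x - f y"
    and bdd: "\<And>x. b \<le> f x"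
  obtains m where "R a m" "\<And>y. R m y \<Longrightarrow> y = m"
proof -
  have step: "\<exists>y. R x y \<and> (\<forall>z. R x z \<longrightarrow> f y \<le> f z + e)" if e: "e > 0" for x and e :: real
  proof -
    let ?I = "Inf (f ` {z. R x z})"
    have bb: "bdd_below (f ` {z. R x z})"
      using bdd by (auto intro!: bdd_belowI)
    have "f ` {z. R x z} \<noteq> {}" using refl by blast
    then obtain y where y: "R x y" "f y < ?I + e"
      using cInf_lessD[of "f ` {z. R x z}" "?I + e"] e by auto
    have "?I \<le> f z" if "R x z" for z
      using that bb by (intro cInf_lower) auto
    with y show ?thesis by (intro exI[of _ y]) force
  qed
  \<comment> \<open>The conjunct for \<open>n = 0\<close> forces the dependent choice to start at
    \<open>a\<close>.\<close>
  have "\<exists>s. \<forall>n. (n = 0 \<longrightarrow> s n = a) \<and> R (s n) (s (Suc n)) \<and>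
          (\<forall>z. R (s n) z \<longrightarrow> f (s (Suc n)) \<le> f z + inverse (real (Suc n)))"
    using dependent_nat_choice[of "\<lambda>n x. n = 0 \<longrightarrow> x = a"
        "\<lambda>n x y. R x y \<and> (\<forall>z. R x z \<longrightarrow> f y \<le> f z + inverse (real (Suc n)))"]
      step by auto
  then obtain s where s0: "s 0 = a" and sR: "\<And>n. R (s n) (s (Suc n))"
    and sf: "\<And>n z. R (s n) z \<Longrightarrow> f (s (Suc n)) \<le> f z + inverse (real (Suc n))"
    by blast
  have mono: "R (s m) (s n)" if "m \<le> n" for m n
    using that by (induction rule: dec_induct) (use refl trans sR in blast)+
  have f_le: "f y \<le> f x" if "R x y" for x y
    using dist[OF that] zero_le_dist[of x y] by linarith
  have "decseq (\<lambda>n. f (s n))"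
    using mono f_le by (auto simp: decseq_def)
  then obtain L where L: "(\<lambda>n. f (s n)) \<longlonglongrightarrow> L"
    using decseq_convergent[of _ b] bdd by blast
  have "Cauchy s"
  proof (rule metric_CauchyI)
    fix e :: real assume "e > 0"
    then obtain M where M: "\<And>m n. m \<ge> M \<Longrightarrow> n \<ge> M \<Longrightarrow> dist (f (s m)) (f (s n)) < e"
      using LIMSEQ_imp_Cauchy[OF L] metric_CauchyD by metis
    have "dist (s m) (s n) < e" if "m \<ge> M" "n \<ge> M" "m \<le> n" for m n
      using dist[OF mono[OF that(3)]] M[OF that(1,2)] by (auto simp: dist_real_def)
    then show "\<exists>M. \<forall>m\<ge>M. \<forall>n\<ge>M. dist (s m) (s n) < e"
      by (metis dist_commute nle_le)
  qed
  then obtain m where m: "s \<longlonglongrightarrow> m"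
    using Cauchy_convergent_iff convergent_def by blast
  have Rm: "R (s n) m" for n
    using Lim_in_closed_set[OF closed[of "s n"] _ _ m] mono
    by (auto intro: eventually_sequentiallyI)
  show thesis
  proof
    show "R a m" using Rm[of 0] s0 by simp
  next
    fix y assume y: "R m y"
    \<comment> \<open>\<open>y\<close> lies above \<open>s n\<close> as well, so the near-minimality
      of \<open>s (Suc n)\<close> applies to it, and \<open>f m\<close> is at most
      \<open>f (s (Suc n))\<close>.\<close>
    have "f m \<le> f y + inverse (real (Suc n))" for n
      using sf[OF trans[OF Rm y], of n] f_le[OF Rm, of "Suc n"] by linarith
    then have "f m \<le> f y"
      by (intro LIMSEQ_le_const[of "\<lambda>n. f y + inverse (real (Suc n))"])
        (use tendsto_add[OF tendsto_const LIMSEQ_inverse_real_of_nat] in auto)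
    then have "dist m y \<le> 0"
      using dist[OF y] by linarith
    then show "y = m" by simp
  qed
qed

text \<open>The right-hand side is itself a face containing \<open>u\<close>, so it contains the
  smallest one. Its condition makes \<open>u\<close> a convex combination of \<open>x\<close>, with
  positive weight \<open>s\<close>, and another point of the ball, namely
  \<open>u - s *\<^sub>R x\<close> divided by \<open>1 - s\<close> when
  \<open>s < 1\<close>.\<close>

lemma face_at_cball_subset:
  fixes u :: "'a::real_normed_vector"
  assumes u: "norm u = 1"
  shows "face_at (cball 0 1) u \<subseteq> {x. norm x \<le> 1 \<and> (\<exists>s. 0 < s \<and> s \<le> 1 \<and> norm (u - s *\<^sub>R x) \<le> 1 - s)}"
    (is "_ \<subseteq> ?F")
proof (rule face_at_smallest(3))
  show "u \<in> ?F"
    using u by (auto intro!: exI[of _ 1])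
  \<comment> \<open>A weight can be lowered by mixing the given decomposition of \<open>u\<close>
    with the trivial one, in which \<open>x\<close> has weight 0. Convexity uses this to give both
    points the common weight \<open>r\<close>.\<close>
  have shrink: "norm (u - t *\<^sub>R x) \<le> 1 - t"
    if "0 < t" "t \<le> s" "norm (u - s *\<^sub>R x) \<le> 1 - s" for s t x
  proof -
    have "u - t *\<^sub>R x = (t / s) *\<^sub>R (u - s *\<^sub>R x) + (1 - t / s) *\<^sub>R u"
      using that by (simp add: algebra_simps)
    also have "norm \<dots> \<le> (t / s) * norm (u - s *\<^sub>R x) + (1 - t / s) * norm u"
      using that by (intro norm_triangle_le) (auto simp: abs_of_nonneg)
    also have "\<dots> \<le> (t / s) * (1 - s) + (1 - t / s)"
      using that u by (simp add: divide_right_mono)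
    also have "\<dots> = 1 - t"
      using that by (simp add: field_simps)
    finally show ?thesis .
  qed
  have "convex ?F"
  proof (rule convexI)
    fix x y and p q :: real
    assume x: "x \<in> ?F" and y: "y \<in> ?F" and pq: "0 \<le> p" "0 \<le> q" "p + q = 1"
    from x y obtain s t where st: "0 < s" "s \<le> 1" "norm (u - s *\<^sub>R x) \<le> 1 - s"
      "0 < t" "t \<le> 1" "norm (u - t *\<^sub>R y) \<le> 1 - t" by blast
    define r where "r = min s t"
    have r: "0 < r" "r \<le> 1" "norm (u - r *\<^sub>R x) \<le> 1 - r" "norm (u - r *\<^sub>R y) \<le> 1 - r"
      using st shrink[of r s x] shrink[of r t y] by (auto simp: r_def)
    have conv: "norm (p *\<^sub>R a + q *\<^sub>R b) \<le> c" if "norm a \<le> c" "norm b \<le> c" for a b :: 'a and c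
    proof -
      have "norm (p *\<^sub>R a + q *\<^sub>R b) \<le> p * norm a + q * norm b"
        using pq by (intro norm_triangle_le) auto
      also have "\<dots> \<le> c"
        using pq that by (intro convex_bound_le)
      finally show ?thesis .
    qed
    have "u - r *\<^sub>R (p *\<^sub>R x + q *\<^sub>R y) = (p + q) *\<^sub>R u - r *\<^sub>R (p *\<^sub>R x + q *\<^sub>R y)"
      using pq by simp
    also have "\<dots> = p *\<^sub>R (u - r *\<^sub>R x) + q *\<^sub>R (u - r *\<^sub>R y)"
      by (simp add: algebra_simps)
    finally have "norm (u - r *\<^sub>R (p *\<^sub>R x + q *\<^sub>R y)) \<le> 1 - r"
      using conv r by metis
    with conv[of x 1 y] x y r show "p *\<^sub>R x + q *\<^sub>R y \<in> ?F" by auto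
  qed
  moreover have "?F \<subseteq> cball 0 1"
    by auto
  moreover have "x \<in> ?F \<and> y \<in> ?F"
    if "x \<in> cball 0 1" "y \<in> cball 0 1" "0 < c" "c < 1" "c *\<^sub>R x + (1 - c) *\<^sub>R y \<in> ?F" for x y and c :: real
  proof -
    have first: "x \<in> ?F"
      if x: "x \<in> cball 0 1" and y: "y \<in> cball 0 1" and c: "0 < c" "c < 1"
        and F: "c *\<^sub>R x + (1 - c) *\<^sub>R y \<in> ?F" for x y and c :: real
    proof -
      from F obtain s where s: "0 < s" "s \<le> 1" "norm (u - s *\<^sub>R (c *\<^sub>R x + (1 - c) *\<^sub>R y)) \<le> 1 - s"
        by blast
      \<comment> \<open>\<open>x\<close> enters \<open>u\<close> with weight \<open>s * c\<close>;
        the share of \<open>y\<close> joins the remainder and adds at most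
        \<open>s * (1 - c)\<close> to its norm.\<close>
      have "u - (s * c) *\<^sub>R x = (u - s *\<^sub>R (c *\<^sub>R x + (1 - c) *\<^sub>R y)) + (s * (1 - c)) *\<^sub>R y"
        by (simp add: algebra_simps)
      also have "norm \<dots> \<le> (1 - s) + s * (1 - c)"
        using s c y by (intro norm_triangle_mono) (auto simp: mult_left_le)
      also have "\<dots> = 1 - s * c"
        by (simp add: algebra_simps)
      finally show ?thesis
        using x s c by (auto intro!: exI[of _ "s * c"] simp: mult_le_one)
    qed
    show ?thesis
      using first[of x y c] first[of y x "1 - c"] that by (simp add: add.commute)
  qed
  ultimately show "?F face_of cball 0 1"
    unfolding face_of_iff_convex_combination by (intro conjI ballI allI impI) (blast | simp)+
qed (use u in auto)

text \<open>Up to scaling, \<open>z\<close> lies in the face of the normalized vector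
  \<open>u\<close>, and the splitting of \<open>u\<close> found for that face is multiplied by
  \<open>norm v\<close>.\<close>

lemma facial_cone_norm_additive:
  assumes "z \<in> facial_cone v" "z \<noteq> 0"
  obtains t where "t > 0" "norm (t *\<^sub>R z) + norm (v - t *\<^sub>R z) \<le> norm v"
proof -
  have v: "v \<noteq> 0" using assms by (auto simp: facial_cone_def)
  define u where "u = v /\<^sub>R norm v"
  have u: "norm u = 1" "v = norm v *\<^sub>R u" using v by (auto simp: u_def)
  from assms v obtain c x where c: "c \<ge> 0" "z = c *\<^sub>R x" "x \<in> face_at (cball 0 1) u"
    by (auto simp: facial_cone_def cone_of_def u_def)
  with assms have "c > 0" by (cases "c = 0") auto
  from c face_at_cball_subset[OF u(1)] obtain s
    where s: "norm x \<le> 1" "0 < s" "norm (u - s *\<^sub>R x) \<le> 1 - s" by blast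
  \<comment> \<open>This factor is the witness \<open>t\<close>: it undoes \<open>c\<close> and
    rescales the weight \<open>s\<close> from \<open>u\<close> to \<open>v\<close>.\<close>
  have tz: "(norm v * s / c) *\<^sub>R z = (norm v * s) *\<^sub>R x"
    using c \<open>c > 0\<close> by simp
  have "v - (norm v * s) *\<^sub>R x = norm v *\<^sub>R (u - s *\<^sub>R x)"
    using u(2) by (simp add: scaleR_diff_right)
  then have "norm (v - (norm v * s) *\<^sub>R x) \<le> norm v * (1 - s)"
    using s by (simp add: mult_left_mono)
  moreover have "norm ((norm v * s) *\<^sub>R x) \<le> norm v * s"
    using s by (simp add: mult_left_le)
  moreover have "norm v * s / c > 0"
    using v s \<open>c > 0\<close> by simp
  moreover have "norm v * s + norm v * (1 - s) = norm v"
    by (simp add: algebra_simps)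
  ultimately show thesis
    using that[of "norm v * s / c"] unfolding tz by linarith
qed

text \<open>Needed because \<open>complementary_set\<close> asks for an intersection equal to
  \<open>{0}\<close>, not just contained in it.\<close>

lemma zero_in_facial_cone: "0 \<in> facial_cone v"
proof (cases "v = 0")
  case False
  then have "v /\<^sub>R norm v \<in> face_at (cball 0 1) (v /\<^sub>R norm v)"
    by (intro face_at_smallest(2)) auto
  then have "0 \<in> (*\<^sub>R) 0 ` face_at (cball 0 1) (v /\<^sub>R norm v)"
    by (auto simp: image_iff)
  with False show ?thesis
    by (auto simp: facial_cone_def cone_of_def intro!: bexI[of _ 0])
qed (simp add: facial_cone_def)

text \<open>The part of the result that concerns only the norm and \<open>W\<close>:
  \<open>w\<close> is a maximal element above 0 for \<open>R\<close>.\<close>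

lemma norm_additive_decomposition:
  fixes W :: "'a::banach set"
  assumes W: "convex_cone W" "closed W"
  obtains w where "w \<in> W" "v - w \<in> complementary_set W" "norm v = norm w + norm (v - w)"
proof -
  define R where "R x y \<longleftrightarrow> y - x \<in> W \<and> norm (y - x) + norm (v - y) \<le> norm (v - x)" for x y
  have W_add: "x + y \<in> W" if "x \<in> W" "y \<in> W" for x y
    using W(1) that by (auto simp: convex_cone_iff)
  have W_scale: "c *\<^sub>R x \<in> W" if "x \<in> W" "c \<ge> 0" for x c
    using W(1) that by (auto simp: convex_cone_iff)
  have W0: "0 \<in> W"
    using W(1) by (auto simp: convex_cone_iff)
  obtain w where w: "R 0 w" and max: "\<And>y. R w y \<Longrightarrow> y = w"
  proof (rule ex_maximal_of_dist_le_decrease[of R "\<lambda>x. norm (v - x)" 0 0])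
    show "R x x" for x using W0 by (simp add: R_def)
    show "R x z" if "R x y" "R y z" for x y z
      using that W_add[of "y - x" "z - y"] norm_triangle_ineq[of "y - x" "z - y"]
      by (auto simp: R_def)
    show "closed {y. R x y}" for x
    proof -
      have "closed ((\<lambda>y. y - x) -` W)"
        by (intro closed_vimage W continuous_intros)
      moreover have "closed {y. norm (y - x) + norm (v - y) \<le> norm (v - x)}"
        by (intro closed_Collect_le continuous_intros)
      moreover have "{y. R x y} = (\<lambda>y. y - x) -` W \<inter> {y. norm (y - x) + norm (v - y) \<le> norm (v - x)}"
        by (auto simp: R_def)
      ultimately show ?thesis by auto
    qed
    show "dist x y \<le> norm (v - x) - norm (v - y)" if "R x y" for x y
      using that by (auto simp: R_def dist_norm norm_minus_commute)
  qed auto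
  have "z = 0" if z: "z \<in> W" "z \<in> facial_cone (v - w)" for z
  proof (rule ccontr)
    assume "z \<noteq> 0"
    with z obtain t where t: "t > 0" "norm (t *\<^sub>R z) + norm (v - w - t *\<^sub>R z) \<le> norm (v - w)"
      by (blast elim: facial_cone_norm_additive)
    \<comment> \<open>The summand \<open>t *\<^sub>R z\<close> of \<open>v - w\<close> can be moved
      over to \<open>w\<close>, against maximality.\<close>
    have "R w (w + t *\<^sub>R z)"
      using t W_scale[OF z(1), of t] by (simp add: R_def diff_diff_eq)
    then have "t *\<^sub>R z = 0" using max by fastforce
    with t \<open>z \<noteq> 0\<close> show False by simp
  qed
  with W0 zero_in_facial_cone[of "v - w"] have "v - w \<in> complementary_set W"
    by (auto simp: complementary_set_def)
  moreover have "w \<in> W" "norm w + norm (v - w) \<le> norm v"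
    using w by (auto simp: R_def)
  moreover have "norm v \<le> norm w + norm (v - w)"
    using norm_triangle_ineq[of w "v - w"] by simp
  ultimately show thesis using that by force
qed

text \<open>With \<open>a = a1 - a2\<close> and \<open>b = b1 - b2\<close> split by
  \<open>OS_1_2\<close>, the sum of all four norms is at most \<open>norm (a + b)\<close>, while
  \<open>norm (a + b)\<close> is at most \<open>norm a1 + norm b1\<close>. Hence \<open>a2\<close>
  and \<open>b2\<close> vanish.\<close>

lemma norm_additive_summands_positive:
  assumes P: "order_smooth_1_normed P" "OS_1_2 P"
    and ab: "a + b \<in> P" "norm a + norm b \<le> norm (a + b)"
  shows "a \<in> P" "b \<in> P"
proof -
  have cone: "convex_cone P"
    using P by (auto simp: order_smooth_1_normed_def proper_cone_def)
  obtain a1 a2 where a: "a1 \<in> P" "a2 \<in> P" "a = a1 - a2" "norm a1 + norm a2 \<le> norm a"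
    using P(2) unfolding OS_1_2_def by meson
  obtain b1 b2 where b: "b1 \<in> P" "b2 \<in> P" "b = b1 - b2" "norm b1 + norm b2 \<le> norm b"
    using P(2) unfolding OS_1_2_def by meson
  have "cone_le P 0 (a + b)"
    using ab by (simp add: cone_le_def)
  moreover have "cone_le P (a + b) (a1 + b1)"
  proof -
    have "a1 + b1 - (a + b) = a2 + b2" using a b by simp
    then show ?thesis
      using a b cone by (simp add: cone_le_def convex_cone_iff)
  qed
  \<comment> \<open>This is (O.1.1) for the chain from 0 over \<open>a + b\<close> to
    \<open>a1 + b1\<close>.\<close>
  ultimately have "norm (a + b) \<le> norm (0::'a) + norm (a1 + b1)"
    using P(1) unfolding order_smooth_1_normed_def by blast
  then have "norm a2 + norm b2 \<le> 0"
    using norm_triangle_ineq[of a1 b1] a b ab by simp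
  then have "a2 = 0" "b2 = 0"
    by (smt (verit) norm_ge_zero norm_le_zero_iff)+
  then show "a \<in> P" "b \<in> P" using a b by auto
qed

theorem theorem2p1:
  fixes P W :: "'a::banach set" and v :: 'a
  assumes "order_smooth_1_normed P"
    and "OS_1_2 P"
    and "convex_cone W" and "closed W"
    and "v \<in> P"
  shows "\<exists>w \<in> W \<inter> P. \<exists>w' \<in> complementary_set W \<inter> P.
           v = w + w' \<and> norm v = norm w + norm w'"
proof -
  obtain w where w: "w \<in> W" "v - w \<in> complementary_set W" "norm v = norm w + norm (v - w)"
    using norm_additive_decomposition[OF assms(3,4)] .
  moreover have "w \<in> P" "v - w \<in> P"
    using norm_additive_summands_positive[OF assms(1,2), of w "v - w"] w assms(5) by auto
  ultimately show ?thesis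
    by (intro bexI[of _ w] bexI[of _ "v - w"]) auto
qed

end
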